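(* Let $0<\alpha<1$, let $f(t)=(t-d)^{\beta}$ with $d,\beta\in\mathbb{R}$, and suppose $t\in\Omega\subset\mathbb{R}$, where $\Omega$ is an interval where $f$ is properly defined as a real-valued function. Then, with $\epsilon=|d-a|>0$ in all cases below: (I) $$\left[{}_{a}D_{t}^{\alpha}(x-d)^{\beta}\right](t)=\sum_{k=0}^{\infty}\frac{\Gamma(\beta+1)\,(a-d)^{\beta-k}\,(t-a)^{-\alpha+k}}{\Gamma(\beta-k+1)\,\Gamma(-\alpha+k+1)},\qquad t\in\left[a,a+\tfrac{\epsilon}{2}\right).$$ (II) $$\left[{}_{d^{+}}D_{t}^{\alpha}(x-d)^{\beta}\right](t)=\sum_{k=0}^{\infty}\frac{\Gamma(\beta+1)\,\epsilon^{\beta-k}\,(t-d^{+})^{-\alpha+k}}{\Gamma(\beta-k+1)\,\Gamma(-\alpha+k+1)},\qquad t\in\left[d^{+},d^{+}+\epsilon\right).$$ Particularly, if $\beta=m\in\mathbb{N}_0$, then $$\left[{}_{a}D_{t}^{\alpha}(x-d)^{m}\right](t)=\sum_{k=0}^{m}\frac{\Gamma(m+1)\,(a-d)^{m-k}\,(t-a)^{k-\alpha}}{\Gamma(m-k+1)\,\Gamma(k+1-\alpha)},\qquad a,t\in\mathbb{R},$$ while if $\beta=-m$ with $m\in\mathbb{N}$, then the following expressions can alternatively be used as well: $$\left[{}_{a}D_{t}^{\alpha}(x-d)^{-m}\right](t)=\sum_{k=0}^{\infty}\frac{(-1)^{k}\,\Gamma(m+k)\,(a-d)^{-m-k}\,(t-a)^{-\alpha+k}}{\Gamma(m)\,\Gamma(-\alpha+k+1)},$$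 $$\left[{}_{d^{+}}D_{t}^{\alpha}(x-d)^{-m}\right](t)=\sum_{k=0}^{\infty}\frac{(-1)^{k}\,\Gamma(m+k)\,\epsilon^{-(m+k)}\,(t-d^{+})^{-\alpha+k}}{\Gamma(m)\,\Gamma(-\alpha+k+1)},$$ with $t\in\left[a,a+\tfrac{\epsilon}{2}\right)$ and $t\in\left[d^{+},d^{+}+\epsilon\right)$, respectively.
   Context: $\mathbb{N}=\{1,2,\dots\}$ and $\mathbb{N}_0=\mathbb{N}\cup\{0\}$. The real number $a$ is the lower limit of the operator. The symbol $d^{+}$ denotes a lower limit $a$ lying to the right of $d$, so that $d^{+}=d+\epsilon$ with $\epsilon=|d-a|>0$. The (leftwise) Riemann-Liouville fractional integral of order $\alpha>0$ of $g\in L_1([a,b])$ is $$[{}_{a}J_{t}^{\alpha}g(x)](t)=\frac{1}{\Gamma(\alpha)}\int_a^t (t-x)^{\alpha-1}g(x)\,dx .$$ The (leftwise) Riemann-Liouville fractional derivative of order $0<\alpha<1$, defined for $g$ absolutely continuous on $[a,b]$, is $$[{}_{a}D_{t}^{\alpha}g(x)](t)=\frac{d}{dt}[{}_{a}J_{t}^{1-\alpha}g(x)](t)=\frac{d}{dt}\frac{1}{\Gamma(1-\alpha)}\int_a^t (t-x)^{-\alpha}g(x)\,dx ;$$ the same expression is the one evaluated for $g(x)=(x-d)^{\beta}$. Real domain of $f(t)=(t-d)^{\beta}$ ("properly defined as a real-valued function" refers to this domain): $\mathbb{R}$ if $\beta\in\mathbb{N}_0$; $\mathbb{R}\setminus\{d\}$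 if $\beta$ is a negative integer; if $\beta=p/q$ is a non-integer rational with $p\in\mathbb{Z}$, $q\in\mathbb{N}$, then $(t-d)^{\beta}=\sqrt[q]{(t-d)^{p}}$ and the domain is $\mathbb{R}$ if $p$ is an even positive integer, $[d,\infty)$ if $p$ is an odd positive integer, and $(d,\infty)$ if $p$ is a negative integer; if $\beta$ is irrational, $(t-d)^{\beta}=e^{\beta\ln(t-d)}$ with domain $(d,\infty)$. $\Gamma$ is the analytically extended gamma function, with $\Gamma(-n)\to\pm\infty$ for $n\in\mathbb{N}_0$ (so its reciprocal there is $0$ when the numerator is finite); ratios of gamma functions at non-positive integers are interpreted by $\frac{\Gamma(-n)}{\Gamma(-m)}=(-1)^{m-n}\frac{m!}{n!}$ for $m,n\in\mathbb{N}_0$. Thus $\frac{\Gamma(\beta+1)}{\Gamma(\beta-k+1)}=\beta(\beta-1)\cdots(\beta-k+1)$ (equal to $1$ for $k=0$). *)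

theory Defs
  imports "HOL-Analysis.Analysis"
begin

text \<open>For rational \<open>\<beta>\<close>, \<open>\<beta> = rat_num \<beta> / rat_den \<beta>\<close> in lowest terms with positive denominator.
  Lowest terms are essential: the parity of the numerator decides the real domain of a power.\<close>

definition rat_num :: "real \<Rightarrow> int" where
  "rat_num \<beta> = fst (quotient_of (THE r. real_of_rat r = \<beta>))"

definition rat_den :: "real \<Rightarrow> nat" where
  "rat_den \<beta> = nat (snd (quotient_of (THE r. real_of_rat r = \<beta>)))"

text \<open>The real power \<open>x\<^sup>\<beta>\<close>. Unlike \<open>powr\<close>, it is meaningful for negative \<open>x\<close> when
  \<open>\<beta>\<close> is rational with odd denominator (\<open>root n\<close> is the signed root for odd \<open>n\<close>);
  integer exponents are the case of denominator 1.\<close>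

definition rpow :: "real \<Rightarrow> real \<Rightarrow> real" where
  "rpow x \<beta> = (if \<beta> \<in> \<rat> then root (rat_den \<beta>) (x powi rat_num \<beta>) else exp (\<beta> * ln x))"

text \<open>The real domain of \<open>t \<mapsto> (t - d)\<^sup>\<beta>\<close>.\<close>

definition rpow_domain :: "real \<Rightarrow> real \<Rightarrow> real set" where
  "rpow_domain d \<beta> =
    (if \<beta> \<in> \<nat> then UNIV
     else if \<beta> \<in> \<int> then UNIV - {d}
     else if \<beta> \<in> \<rat> \<and> rat_num \<beta> > 0 then (if even (rat_num \<beta>) then UNIV else {d..})
     else {d<..})"

text \<open>The quotient \<open>\<Gamma>(x)/\<Gamma>(y)\<close>, with \<open>\<Gamma>(-n)/\<Gamma>(-m) = (-1)\<^bsup>m-n\<^esup> m!/n!\<close> when both arguments are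
  poles; \<open>rGamma\<close> is the reciprocal \<open>1/\<Gamma>\<close>, which vanishes at the poles.
  If only \<open>x\<close> is a pole the quotient has no meaning.\<close>

definition Gamma_ratio :: "real \<Rightarrow> real \<Rightarrow> real" where
  "Gamma_ratio x y =
    (if x \<in> \<int>\<^sub>\<le>\<^sub>0 \<and> y \<in> \<int>\<^sub>\<le>\<^sub>0
     then let n = nat \<lfloor>- x\<rfloor>; m = nat \<lfloor>- y\<rfloor>
          in (-1) powi (int m - int n) * fact m / fact n
     else Gamma x * rGamma y)"

definition RL_integral :: "real \<Rightarrow> real \<Rightarrow> (real \<Rightarrow> real) \<Rightarrow> real \<Rightarrow> real" where
  "RL_integral a \<alpha> g t = 1 / Gamma \<alpha> * (LBINT x:{a..t}. (t - x) powr (\<alpha> - 1) * g x)"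

text \<open>\<open>D\<close> is the value at \<open>t \<ge> a\<close> of the Riemann-Liouville derivative of order \<open>\<alpha>\<close> of \<open>g\<close> with
  lower limit \<open>a\<close>. The first conjunct says that the fractional integral of order \<open>1 - \<alpha>\<close> exists
  on an interval reaching beyond \<open>t\<close>. For \<open>t > a\<close> the derivative is an ordinary (finite,
  two-sided) one. At the lower limit \<open>t = a\<close> it is the right-hand derivative, which
  is infinite as soon as \<open>g\<close> is continuous with \<open>g a \<noteq> 0\<close>, so values are extended reals.\<close>

definition has_RL_derivative ::
    "real \<Rightarrow> real \<Rightarrow> (real \<Rightarrow> real) \<Rightarrow> real \<Rightarrow> ereal \<Rightarrow> bool" where
  "has_RL_derivative a \<alpha> g t D \<longleftrightarrow>
    (\<exists>b>t. \<forall>s\<in>{a..b}. set_integrable lborel {a..s} (\<lambda>x. (s - x) powr (1 - \<alpha> - 1) * g x)) \<and>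
    (if t > a
     then \<exists>D'. D = ereal D' \<and> (RL_integral a (1 - \<alpha>) g has_real_derivative D') (at t)
     else t = a \<and>
       ((\<lambda>s. ereal ((RL_integral a (1 - \<alpha>) g s - RL_integral a (1 - \<alpha>) g a) / (s - a))) \<longlongrightarrow> D)
         (at_right a))"

text \<open>Powers of a base \<open>x \<ge> 0\<close>, with \<open>0\<^sup>r = \<infinity>\<close> for \<open>r < 0\<close> (whereas \<open>0 powr r = 0\<close>).\<close>

definition epowr :: "real \<Rightarrow> real \<Rightarrow> ereal" where
  "epowr x r = (if x = 0 \<and> r < 0 then \<infinity> else ereal (x powr r))"

end

theory Submission
  imports Defs
begin

text \<open>Expand the power at the lower limit \<open>a\<close> as a binomial series,
  \<open>(x - d)\<^sup>\<beta> = \<Sum>k. (\<beta> gchoose k) (a - d)\<^bsup>\<beta>-k\<^esup> (x - a)\<^sup>k\<close>, and differentiate term by term. The Beta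
  integral turns \<open>(x - a)\<^sup>k\<close> into \<open>k! / \<Gamma>(k + 1 - \<alpha>) (t - a)\<^bsup>k-\<alpha>\<^esup>\<close>, and
  \<open>k! (\<beta> gchoose k)\<close> is \<open>\<Gamma>(\<beta> + 1) / \<Gamma>(\<beta> - k + 1)\<close> (\<open>Gamma_ratio_eq_gbinomial\<close>).

  The analytic part, \<open>has_RL_derivative_power_series\<close>, concerns an arbitrary power series centred
  at the lower limit. Instead of differentiating infinitely many singular terms
  \<open>(t - a)\<^bsup>k-\<alpha>\<^esup>\<close>, it writes the fractional integral as the single factor \<open>(t - a)\<^bsup>1-\<alpha>\<^esup>\<close> times an
  ordinary power series. The latter may be differentiated termwise, and its constant
  term decides between \<open>\<infinity>\<close> and \<open>-\<infinity>\<close> at \<open>t = a\<close>.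

  The algebraic part, \<open>rpow_binomial_series\<close>, extends the binomial series to negative bases. A
  point \<open>t < d\<close> in the domain forces the exponent to be a fraction with odd denominator
  (\<open>rpow_domain_left\<close>), for which signed roots obey the power laws that are needed.

  Both expansions, at \<open>a\<close> and at \<open>d\<^sup>+\<close>, are instances of the same lemma
  \<open>has_RL_derivative_rpow\<close>, since the centre of each has distance \<open>\<epsilon>\<close> from \<open>d\<close>. For \<open>\<beta> = m\<close> the
  series terminates and converges everywhere; for \<open>\<beta> = -m\<close> only the coefficients are
  rewritten (\<open>Gamma_ratio_neg_nat\<close>).\<close>

section \<open>Fractional integrals and derivatives of power series\<close>

text \<open>Euler's Beta integral \<open>B(k + 1, \<mu>)\<close>. The power is a natural one, whose value at
  \<open>x = 0\<close> is 1 for \<open>k = 0\<close>, whereas \<open>0 powr 0 = 0\<close>; this affects the integrand at one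
  point only. Since the integrand is nonnegative, gauge integrability gives Lebesgue
  integrability.\<close>

lemma beta_integral_unit:
  fixes \<mu> :: real
  assumes "\<mu> > 0"
  shows "has_bochner_integral lborel (\<lambda>x. indicator {0..1} x *\<^sub>R ((1 - x) powr (\<mu> - 1) * x ^ k))
           (Gamma \<mu> * fact k / Gamma (real k + 1 + \<mu>))"
proof -
  let ?f = "\<lambda>x::real. (1 - x) powr (\<mu> - 1) * x ^ k"
  have "((\<lambda>x. x powr (real k + 1 - 1) * (1 - x) powr (\<mu> - 1)) has_integral Beta (real k + 1) \<mu>) {0..1}"
    using assms by (intro has_integral_Beta_real) auto
  then have I: "(?f has_integral Beta (real k + 1) \<mu>) {0..1}"
    by (rule has_integral_spike_finite[where S = "{0}", rotated 2]) (auto simp: powr_realpow)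
  then have "?f absolutely_integrable_on {0..1}"
    by (intro nonnegative_absolutely_integrable_1) (auto simp: integrable_on_def)
  then have S: "set_integrable lborel {0..1} ?f"
    unfolding set_integrable_def by (subst (asm) integrable_completion) auto
  have "(LINT x:{0..1}|lborel. ?f x) = Beta (real k + 1) \<mu>"
    using set_borel_integral_eq_integral(2)[OF S] I by (simp add: integral_unique)
  moreover have "Beta (real k + 1) \<mu> = Gamma \<mu> * fact k / Gamma (real k + 1 + \<mu>)"
    using Gamma_fact[of k, where 'a = real] by (simp add: Beta_def add.commute)
  ultimately show ?thesis
    using S by (simp add: has_bochner_integral_iff set_integrable_def set_lebesgue_integral_def)
qed

text \<open>The substitution \<open>x = a + (s - a) y\<close> reduces the integral to the one over the unit interval.\<close>

lemma beta_integral_monomial: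
  fixes \<mu> a s :: real
  assumes "\<mu> > 0" "a < s"
  shows "has_bochner_integral lborel
           (\<lambda>x. indicator {a..s} x *\<^sub>R ((s - x) powr (\<mu> - 1) * (x - a) ^ k))
           (Gamma \<mu> * fact k / Gamma (real k + 1 + \<mu>) * ((s - a) powr \<mu> * (s - a) ^ k))"
proof -
  define u where "u = s - a"
  have u: "u > 0" "s = a + u" using assms by (auto simp: u_def)
  let ?B = "Gamma \<mu> * fact k / Gamma (real k + 1 + \<mu>)"
  have ind: "indicator {a..s} (a + u * x) = (indicator {0..1} x :: real)" for x
    using u by (auto simp: indicator_def mult_le_cancel_left1 zero_le_mult_iff)
  have weight: "(u - u * x) powr (\<mu> - 1) = u powr (\<mu> - 1) * (1 - x) powr (\<mu> - 1)"
    if "x \<in> {0..1}" for x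
    using u that by (subst powr_mult[symmetric]) (auto simp: algebra_simps)
  let ?f = "\<lambda>x. indicator {a..s} x *\<^sub>R ((s - x) powr (\<mu> - 1) * (x - a) ^ k)"
  have val: "(u powr (\<mu> - 1) * u ^ k) * ?B = ?B * (u powr \<mu> * u ^ k) /\<^sub>R \<bar>u\<bar>"
    using u by (simp add: powr_diff field_simps)
  have integrand: "(u powr (\<mu> - 1) * u ^ k) * (indicator {0..1} x *\<^sub>R ((1 - x) powr (\<mu> - 1) * x ^ k))
      = ?f (a + u * x)" for x
    unfolding ind by (auto simp: indicator_def weight u power_mult_distrib)
  have "has_bochner_integral lborel
      (\<lambda>x. (u powr (\<mu> - 1) * u ^ k) *
             (indicator {0..1} x *\<^sub>R ((1 - x) powr (\<mu> - 1) * x ^ k)))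
      ((u powr (\<mu> - 1) * u ^ k) * ?B)"
    using assms by (intro has_bochner_integral_mult_right beta_integral_unit) auto
  then have "has_bochner_integral lborel (\<lambda>x. ?f (a + u * x)) (?B * (u powr \<mu> * u ^ k) /\<^sub>R \<bar>u\<bar>)"
    unfolding val integrand .
  then have "has_bochner_integral lborel ?f (?B * (u powr \<mu> * u ^ k))"
    by (rule lborel_has_bochner_integral_real_affine_iff[THEN iffD2, rotated]) (use u in simp)
  then show ?thesis by (simp only: u_def)
qed

text \<open>The coefficients that integration of order \<open>\<mu>\<close> introduces decrease in \<open>k\<close>, since consecutive
  ones have the ratio \<open>(k + 1) / (k + 1 + \<mu>) < 1\<close>. Hence integrating a power series does not
  shrink its interval of convergence.\<close>

lemma fact_over_Gamma_le:
  fixes \<mu> :: real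
  assumes "\<mu> > 0"
  shows "fact k / Gamma (real k + 1 + \<mu>) \<le> 1 / Gamma (1 + \<mu>)"
proof (induction k)
  case 0
  show ?case by (simp add: add.commute)
next
  case (Suc k)
  have G: "Gamma (real (Suc k) + 1 + \<mu>) = (real k + 1 + \<mu>) * Gamma (real k + 1 + \<mu>)"
    using Gamma_plus1[of "real k + 1 + \<mu>"] assms
    by (auto simp: add_ac nonpos_Ints_def)
  have "fact (Suc k) / Gamma (real (Suc k) + 1 + \<mu>)
      = (real k + 1) / (real k + 1 + \<mu>) * (fact k / Gamma (real k + 1 + \<mu>))"
    unfolding G by simp
  also have "\<dots> \<le> 1 * (fact k / Gamma (real k + 1 + \<mu>))"
    using assms by (intro mult_right_mono) (auto intro!: less_imp_le[OF Gamma_real_pos])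
  finally show ?case using Suc by simp
qed

lemma summable_RL_series:
  fixes c :: "nat \<Rightarrow> real"
  assumes "\<mu> > 0"
    and sums: "\<And>x. a \<le> x \<Longrightarrow> x < a + \<rho> \<Longrightarrow> summable (\<lambda>k. c k * (x - a) ^ k)"
    and u: "\<bar>u\<bar> < \<rho>"
  shows "summable (\<lambda>k. \<bar>c k\<bar> * fact k / Gamma (real k + 1 + \<mu>) * \<bar>u\<bar> ^ k)"
proof -
  (* Absolute convergence at u needs convergence at a point farther from the centre. *)
  define v where "v = (\<bar>u\<bar> + \<rho>) / 2"
  have v: "\<bar>u\<bar> < v" "v < \<rho>" using u by (auto simp: v_def)
  have "summable (\<lambda>k. c k * v ^ k)" using sums[of "a + v"] v by simp
  then have "summable (\<lambda>k. norm (c k * \<bar>u\<bar> ^ k))"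
    by (rule powser_insidea) (use v in auto)
  then have "summable (\<lambda>k. 1 / Gamma (1 + \<mu>) * (\<bar>c k\<bar> * \<bar>u\<bar> ^ k))"
    by (intro summable_mult) (simp add: abs_mult power_abs)
  then show ?thesis
  proof (rule summable_comparison_test[rotated], intro exI allI impI)
    fix k
    have "fact k / Gamma (real k + 1 + \<mu>) * (\<bar>c k\<bar> * \<bar>u\<bar> ^ k)
        \<le> 1 / Gamma (1 + \<mu>) * (\<bar>c k\<bar> * \<bar>u\<bar> ^ k)"
      by (intro mult_right_mono fact_over_Gamma_le assms) auto
    moreover have "Gamma (real k + 1 + \<mu>) > 0" using assms by (intro Gamma_real_pos) auto
    ultimately show "norm (\<bar>c k\<bar> * fact k / Gamma (real k + 1 + \<mu>) * \<bar>u\<bar> ^ k)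
        \<le> 1 / Gamma (1 + \<mu>) * (\<bar>c k\<bar> * \<bar>u\<bar> ^ k)"
      by (simp add: abs_mult mult_ac)
  qed
qed

text \<open>Integral and sum may be exchanged because the integrals of the absolute values of the
  terms are, up to a common factor, the terms of the series in the preceding lemma at
  \<open>u = s - a\<close>. Integrability of the integrand, which the derivative presupposes,
  comes out of the same exchange.\<close>

lemma RL_integral_power_series:
  fixes c :: "nat \<Rightarrow> real"
  assumes \<mu>: "\<mu> > 0"
    and g: "\<And>x. a \<le> x \<Longrightarrow> x < a + \<rho> \<Longrightarrow> (\<lambda>k. c k * (x - a) ^ k) sums g x"
    and s: "a \<le> s" "s < a + \<rho>"
  shows "set_integrable lborel {a..s} (\<lambda>x. (s - x) powr (\<mu> - 1) * g x)" (is ?int)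
    and "RL_integral a \<mu> g s =
           (s - a) powr \<mu> * (\<Sum>k. c k * fact k / Gamma (real k + 1 + \<mu>) * (s - a) ^ k)" (is ?val)
proof -
  have "?int \<and> ?val"
  proof (cases "s = a")
    case True
    have "(\<lambda>x. indicator {a..a} x *\<^sub>R ((a - x) powr (\<mu> - 1) * g x)) = (\<lambda>_. 0)"
      by (auto simp: indicator_def)
    with True show ?thesis
      by (simp add: set_integrable_def RL_integral_def set_lebesgue_integral_def)
  next
    case False
    with s have as: "a < s" by simp
    let ?B = "\<lambda>k. Gamma \<mu> * fact k / Gamma (real k + 1 + \<mu>)"
    let ?m = "\<lambda>k x. indicator {a..s} x *\<^sub>R ((s - x) powr (\<mu> - 1) * (x - a) ^ k)"
    define F where "F = (\<lambda>k x. c k * ?m k x)"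
    let ?G = "\<lambda>x. indicator {a..s} x *\<^sub>R ((s - x) powr (\<mu> - 1) * g x)"
    have bi: "has_bochner_integral lborel (F k) (c k * (?B k * ((s - a) powr \<mu> * (s - a) ^ k)))"
      for k unfolding F_def
      by (intro has_bochner_integral_mult_right beta_integral_monomial \<mu> as)
    have norm_F: "norm (F k x) = \<bar>c k\<bar> * ?m k x" for k x
      by (auto simp: F_def abs_mult indicator_def)
    have bin: "has_bochner_integral lborel (\<lambda>x. norm (F k x))
        (\<bar>c k\<bar> * (?B k * ((s - a) powr \<mu> * (s - a) ^ k)))" for k
      unfolding norm_F
      by (intro has_bochner_integral_mult_right beta_integral_monomial \<mu> as)
    have F_sums: "(\<lambda>k. F k x) sums ?G x" for x
    proof (cases "x \<in> {a..s}")
      case True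
      then have "(\<lambda>k. c k * (x - a) ^ k) sums g x" using s by (intro g) auto
      then have "(\<lambda>k. (s - x) powr (\<mu> - 1) * (c k * (x - a) ^ k)) sums ((s - x) powr (\<mu> - 1) * g x)"
        by (rule sums_mult)
      then show ?thesis using True by (simp add: F_def mult_ac)
    qed (auto simp: F_def)
    have F_abs: "summable (\<lambda>k. norm (F k x))" for x
    proof (cases "x \<in> {a..s}")
      case True
      have sm: "summable (\<lambda>k. c k * ((x + a + \<rho>) / 2 - a) ^ k)"
        using g[of "(x + a + \<rho>) / 2"] True s by (auto simp: sums_iff)
      have "summable (\<lambda>k. norm (c k * (x - a) ^ k))"
        by (rule powser_insidea[OF sm]) (use True s in auto)
      then have "summable (\<lambda>k. (s - x) powr (\<mu> - 1) * norm (c k * (x - a) ^ k))"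
        by (rule summable_mult)
      then show ?thesis using True unfolding norm_F by (simp add: abs_mult mult_ac)
    qed (auto simp: F_def)
    have "summable (\<lambda>k. \<bar>c k\<bar> * fact k / Gamma (real k + 1 + \<mu>) * \<bar>s - a\<bar> ^ k)"
      using g s by (intro summable_RL_series[where a = a and \<rho> = \<rho>] \<mu>) (auto simp: sums_iff)
    then have "summable (\<lambda>k. (Gamma \<mu> * (s - a) powr \<mu>) *
        (\<bar>c k\<bar> * fact k / Gamma (real k + 1 + \<mu>) * \<bar>s - a\<bar> ^ k))"
      by (rule summable_mult)
    then have sm_int: "summable (\<lambda>k. \<integral>x. norm (F k x) \<partial>lborel)"
      unfolding has_bochner_integral_integral_eq[OF bin] using as by (simp add: mult_ac)
    have F_int: "integrable lborel (F k)" for k using bi by (simp add: has_bochner_integral_iff)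
    have G_eq: "(\<lambda>x. \<Sum>k. F k x) = ?G" using F_sums by (auto simp: sums_iff)
    have "integrable lborel ?G"
      using integrable_suminf[of lborel F] F_int F_abs sm_int by (simp add: G_eq)
    moreover have "(\<lambda>k. integral\<^sup>L lborel (F k)) sums (\<integral>x. ?G x \<partial>lborel)"
      using sums_integral[of lborel F] F_int F_abs sm_int by (simp add: G_eq)
    then have "(\<lambda>k. (c k * (?B k * ((s - a) powr \<mu> * (s - a) ^ k))) / Gamma \<mu>)
        sums ((\<integral>x. ?G x \<partial>lborel) / Gamma \<mu>)"
      unfolding has_bochner_integral_integral_eq[OF bi] by (rule sums_divide)
    then have "(\<lambda>k. (s - a) powr \<mu> * (c k * fact k / Gamma (real k + 1 + \<mu>) * (s - a) ^ k))
        sums RL_integral a \<mu> g s"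
      using Gamma_real_pos[OF \<mu>]
      by (simp add: RL_integral_def set_lebesgue_integral_def mult_ac)
    from sums_divide[OF this, of "(s - a) powr \<mu>"]
    have "(\<lambda>k. c k * fact k / Gamma (real k + 1 + \<mu>) * (s - a) ^ k)
        sums (RL_integral a \<mu> g s / (s - a) powr \<mu>)"
      using as by simp
    then have "RL_integral a \<mu> g s =
        (s - a) powr \<mu> * (\<Sum>k. c k * fact k / Gamma (real k + 1 + \<mu>) * (s - a) ^ k)"
      using as by (simp add: sums_iff field_simps)
    ultimately show ?thesis by (simp add: set_integrable_def)
  qed
  then show ?int ?val by auto
qed

text \<open>By the preceding lemma, the fractional integral of order \<open>\<mu> = 1 - \<alpha>\<close> is \<open>u\<^sup>\<mu> H(u)\<close> with
  \<open>u = s - a\<close> and a power series \<open>H\<close>. For \<open>u > 0\<close> the product rule and termwise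
  differentiation of \<open>H\<close> give the claim, because \<open>(\<mu> + k) / \<Gamma>(k + 1 + \<mu>) = 1 / \<Gamma>(k + \<mu>)\<close>.
  At \<open>u = 0\<close> the difference quotient is \<open>u\<^bsup>-\<alpha>\<^esup> H(u)\<close>, which tends to \<open>\<plusminus>\<infinity>\<close> with the sign of
  \<open>H(0)\<close>, i.e. of \<open>c 0\<close>; in the series only the term \<open>k = 0\<close> survives there, and it
  has the same infinite value. For \<open>c 0 = 0\<close> that comparison would involve \<open>0 \<cdot> \<infinity>\<close>.\<close>

lemma has_RL_derivative_power_series:
  fixes c :: "nat \<Rightarrow> real"
  assumes \<alpha>: "0 < \<alpha>" "\<alpha> < 1"
    and g: "\<And>x. a \<le> x \<Longrightarrow> x < a + \<rho> \<Longrightarrow> (\<lambda>k. c k * (x - a) ^ k) sums g x"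
    and t: "a \<le> t" "t < a + \<rho>"
    and c0: "c 0 \<noteq> 0"
  shows "\<exists>D. has_RL_derivative a \<alpha> g t D \<and>
    (\<lambda>k. ereal (c k * fact k / Gamma (- \<alpha> + real k + 1)) * epowr (t - a) (- \<alpha> + real k)) sums D"
proof -
  define \<mu> where "\<mu> = 1 - \<alpha>"
  have \<mu>: "\<mu> > 0" using \<alpha> by (simp add: \<mu>_def)
  define h where "h = (\<lambda>k. c k * fact k / Gamma (real k + 1 + \<mu>))"
  define H where "H = (\<lambda>u. \<Sum>k. h k * u ^ k)"
  let ?J = "RL_integral a \<mu> g"
  have J: "?J s = (s - a) powr \<mu> * H (s - a)" if "a \<le> s" "s < a + \<rho>" for s
    using RL_integral_power_series(2)[OF \<mu> g that] by (simp add: H_def h_def)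
  have smh: "summable (\<lambda>k. h k * u ^ k)" if "norm u < \<rho>" for u
  proof (rule summable_norm_cancel)
    have "Gamma (real k + 1 + \<mu>) > 0" for k using \<mu> by (intro Gamma_real_pos) auto
    then have "norm (h k * u ^ k) = \<bar>c k\<bar> * fact k / Gamma (real k + 1 + \<mu>) * \<bar>u\<bar> ^ k" for k
      by (simp add: h_def abs_mult power_abs abs_of_pos)
    then show "summable (\<lambda>k. norm (h k * u ^ k))"
      using summable_RL_series[of \<mu> a \<rho> c u] \<mu> g that by (simp add: sums_iff)
  qed
  have H_deriv: "(H has_real_derivative (\<Sum>k. diffs h k * u ^ k)) (at u)" if "norm u < \<rho>" for u
    unfolding H_def using smh that by (rule termdiffs_strong')
  have h_Gamma: "(\<mu> + real k) * h k = c k * fact k / Gamma (- \<alpha> + real k + 1)" for k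
  proof -
    have "Gamma (real k + 1 + \<mu>) = (\<mu> + real k) * Gamma (\<mu> + real k)"
      using Gamma_plus1[of "\<mu> + real k"] \<mu> by (auto simp: add_ac nonpos_Ints_def)
    moreover have "- \<alpha> + real k + 1 = \<mu> + real k" by (simp add: \<mu>_def)
    ultimately have "h k = c k * fact k / ((\<mu> + real k) * Gamma (- \<alpha> + real k + 1))"
      by (simp only: h_def)
    moreover have "\<mu> + real k > 0" using \<mu> by simp
    ultimately show ?thesis by simp
  qed
  have int: "\<exists>b>t. \<forall>s\<in>{a..b}. set_integrable lborel {a..s} (\<lambda>x. (s - x) powr (1 - \<alpha> - 1) * g x)"
  proof (intro exI conjI ballI)
    (* The midpoint of t and the right end of the interval of convergence. *)
    show "t < (t + a + \<rho>) / 2" using t by simp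
    fix s assume "s \<in> {a..(t + a + \<rho>) / 2}"
    then show "set_integrable lborel {a..s} (\<lambda>x. (s - x) powr (1 - \<alpha> - 1) * g x)"
      unfolding \<mu>_def[symmetric] using t
      by (intro RL_integral_power_series(1)[where \<rho> = \<rho> and c = c] \<mu> g) auto
  qed
  show ?thesis
  proof (cases "t > a")
    case True
    define u where "u = t - a"
    have u: "u > 0" "norm u < \<rho>" using True t by (auto simp: u_def)
    let ?D = "\<mu> * u powr (\<mu> - 1) * H u + u powr \<mu> * (\<Sum>k. diffs h k * u ^ k)"
    have "((\<lambda>s. (s - a) powr \<mu> * H (s - a)) has_real_derivative ?D) (at t)"
      using u by (auto intro!: derivative_eq_intros DERIV_chain2[OF H_deriv] simp: u_def)
    then have "(?J has_real_derivative ?D) (at t)"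
    proof (rule has_field_derivative_transform_within_open)
      show "open {a<..<a + \<rho>}" "t \<in> {a<..<a + \<rho>}" using True t by auto
    qed (auto simp: J)
    then have deriv: "has_RL_derivative a \<alpha> g t (ereal ?D)"
      using int True by (auto simp: has_RL_derivative_def \<mu>_def)
    have "(\<lambda>k. real k * h k * u ^ (k - Suc 0)) sums (\<Sum>k. diffs h k * u ^ k)"
      using diffs_equiv[of h u] termdiff_converges[OF u(2) smh] by simp
    moreover have "(\<lambda>k. h k * u ^ k) sums H u"
      unfolding H_def using smh u(2) by (intro summable_sums) auto
    ultimately have "(\<lambda>k. \<mu> * u powr (\<mu> - 1) * (h k * u ^ k)
          + u powr \<mu> * (real k * h k * u ^ (k - Suc 0))) sums ?D"
      by (intro sums_add sums_mult)
    moreover have "\<mu> * u powr (\<mu> - 1) * (h k * u ^ k) + u powr \<mu> * (real k * h k * u ^ (k - Suc 0))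
        = c k * fact k / Gamma (- \<alpha> + real k + 1) * u powr (- \<alpha> + real k)" for k
    proof -
      have "u powr \<mu> * (real k * h k * u ^ (k - Suc 0)) = real k * h k * (u powr (\<mu> - 1) * u ^ k)"
        using u by (cases k) (auto simp: powr_diff)
      moreover have "u powr (- \<alpha> + real k) = u powr (\<mu> - 1) * u ^ k"
        using u powr_add[of u "- \<alpha>" "real k"] by (simp add: powr_realpow \<mu>_def)
      ultimately show ?thesis unfolding h_Gamma[symmetric] by (simp add: algebra_simps)
    qed
    ultimately have "(\<lambda>k. ereal (c k * fact k / Gamma (- \<alpha> + real k + 1) *
        u powr (- \<alpha> + real k))) sums ereal ?D"
      by (simp only: sums_ereal)
    moreover have "epowr (t - a) r = ereal (u powr r)" for r
      using u by (simp add: epowr_def u_def)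
    ultimately show ?thesis using deriv by auto
  next
    case False
    with t have ta: "t = a" by simp
    let ?C = "c 0 / Gamma (1 - \<alpha>)"
    have "Gamma (1 + \<mu>) > 0" using \<mu> by (intro Gamma_real_pos) auto
    then have h0: "h 0 \<noteq> 0" using c0 by (simp add: h_def)
    have C_h: "?C = \<mu> * h 0" using h_Gamma[of 0] by simp
    have "(H \<longlongrightarrow> H 0) (at_right 0)"
      using DERIV_isCont[OF H_deriv[of 0]] t ta
      by (auto simp: isCont_def intro: filterlim_at_split[THEN iffD1, THEN conjunct2])
    moreover have "H 0 = h 0" by (simp add: H_def)
    ultimately have "((\<lambda>u. ereal (H u)) \<longlongrightarrow> ereal (h 0)) (at_right 0)"
      by simp
    moreover have "filterlim (\<lambda>u. u powr (\<mu> - 1)) at_top (at_right (0::real))"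
    proof -
      have "((\<lambda>u. u powr \<alpha>) \<longlongrightarrow> 0) (at_right (0::real))"
        using \<alpha> by (intro tendsto_zero_powrI) (auto simp: eventually_at_filter)
      then have "filterlim (\<lambda>u. inverse (u powr \<alpha>)) at_top (at_right (0::real))"
        by (rule filterlim_inverse_at_top) (auto simp: eventually_at_filter)
      then show ?thesis by (simp add: \<mu>_def powr_minus)
    qed
    then have "((\<lambda>u. ereal (u powr (\<mu> - 1))) \<longlongrightarrow> \<infinity>) (at_right (0::real))"
      by (simp add: tendsto_PInfty_eq_at_top)
    ultimately have "((\<lambda>u. ereal (u powr (\<mu> - 1)) * ereal (H u)) \<longlongrightarrow> \<infinity> * ereal (h 0)) (at_right 0)"
      using h0 by (intro tendsto_mult_ereal) auto
    then have "((\<lambda>u. ereal ((?J (a + u) - ?J a) / u)) \<longlongrightarrow> \<infinity> * ereal (h 0)) (at_right 0)"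
    proof (rule Lim_transform_eventually)
      have "eventually (\<lambda>u. u \<in> {0<..<\<rho>}) (at_right 0)"
        using t ta by (intro eventually_at_right_real) auto
      then show "eventually (\<lambda>u. ereal (u powr (\<mu> - 1)) * ereal (H u)
          = ereal ((?J (a + u) - ?J a) / u)) (at_right 0)"
        by eventually_elim (use t ta \<mu> in \<open>auto simp: J powr_diff\<close>)
    qed
    then have lim: "((\<lambda>s. ereal ((?J s - ?J a) / (s - a))) \<longlongrightarrow> \<infinity> * ereal (h 0)) (at_right a)"
      by (subst filterlim_at_right_to_0) (simp add: add.commute)
    have D: "\<infinity> * ereal (h 0) = ereal ?C * \<infinity>"
      using \<mu> h0 unfolding C_h by (auto simp: zero_less_mult_iff mult_less_0_iff)
    have "(\<lambda>k. ereal (c k * fact k / Gamma (- \<alpha> + real k + 1)) * epowr (t - a) (- \<alpha> + real k))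
        sums (\<Sum>k\<in>{0}. ereal (c k * fact k / Gamma (- \<alpha> + real k + 1)) * epowr (t - a) (- \<alpha> + real k))"
      using \<alpha> ta by (intro sums_finite) (auto simp: epowr_def)
    also have "(\<Sum>k\<in>{0}. ereal (c k * fact k / Gamma (- \<alpha> + real k + 1)) * epowr (t - a) (- \<alpha> + real k))
        = ereal ?C * \<infinity>"
      using ta \<alpha> by (simp add: epowr_def)
    finally show ?thesis
      using int ta lim unfolding has_RL_derivative_def D \<mu>_def by auto
  qed
qed

section \<open>Real powers with a negative base\<close>

lemma rat_num_den_eqI:
  assumes "coprime p q" "q > 0" "\<beta> = real_of_int p / real_of_int q"
  shows "rat_num \<beta> = p" "rat_den \<beta> = nat q"
proof -
  have "real_of_rat (Fract p q) = \<beta>"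
    using assms by (simp add: Fract_of_int_quotient of_rat_divide)
  then have "(THE r. real_of_rat r = \<beta>) = Fract p q"
    by (auto intro!: the_equality)
  moreover have "quotient_of (Fract p q) = (p, q)"
    using assms by (simp add: quotient_of_Fract normalize_stable)
  ultimately show "rat_num \<beta> = p" "rat_den \<beta> = nat q"
    by (simp_all add: rat_num_def rat_den_def)
qed

lemma rat_num_den:
  assumes "\<beta> \<in> \<rat>"
  shows "rat_den \<beta> > 0" "coprime (rat_num \<beta>) (int (rat_den \<beta>))"
    "\<beta> = real_of_int (rat_num \<beta>) / real (rat_den \<beta>)"
proof -
  obtain p q where pq: "q > 0" "coprime p q" "\<beta> = of_int p / of_int q"
    using Rats_cases'[OF assms] by metis
  with rat_num_den_eqI[OF pq(2,1,3)]
  show "rat_den \<beta> > 0" "coprime (rat_num \<beta>) (int (rat_den \<beta>))"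
    "\<beta> = real_of_int (rat_num \<beta>) / real (rat_den \<beta>)" by simp_all
qed

text \<open>Subtracting a natural number keeps the fraction in lowest terms, so that the same root is
  taken in \<open>x\<^bsup>\<beta>-k\<^esup>\<close> as in \<open>x\<^sup>\<beta>\<close>.\<close>

lemma rat_num_den_diff_nat:
  assumes "\<beta> \<in> \<rat>"
  shows "rat_num (\<beta> - real k) = rat_num \<beta> - int k * int (rat_den \<beta>)"
    and "rat_den (\<beta> - real k) = rat_den \<beta>"
proof -
  note b = rat_num_den[OF assms]
  have "coprime (rat_num \<beta> - int k * int (rat_den \<beta>)) (int (rat_den \<beta>))"
    using b(2) gcd_add_mult[of "int (rat_den \<beta>)" "- int k" "rat_num \<beta>"]
    by (simp add: coprime_iff_gcd_eq_1 gcd.commute algebra_simps)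
  moreover have "\<beta> - real k = real_of_int (rat_num \<beta> - int k * int (rat_den \<beta>)) / of_int (int (rat_den \<beta>))"
    using b(1) by (subst (1) b(3)) (simp add: diff_divide_distrib)
  ultimately show "rat_num (\<beta> - real k) = rat_num \<beta> - int k * int (rat_den \<beta>)"
    "rat_den (\<beta> - real k) = rat_den \<beta>"
    using rat_num_den_eqI[of "rat_num \<beta> - int k * int (rat_den \<beta>)" "int (rat_den \<beta>)" "\<beta> - real k"]
      b(1) by simp_all
qed

lemma rpow_of_int: "rpow x (real_of_int n) = x powi n"
  using rat_num_den_eqI[of n 1 "real_of_int n"] by (simp add: rpow_def)

lemma rpow_eq_powr:
  assumes "x > 0"
  shows "rpow x \<beta> = x powr \<beta>"
proof (cases "\<beta> \<in> \<rat>")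
  case True
  note b = rat_num_den[OF this]
  have "root (rat_den \<beta>) (x powi rat_num \<beta>) = (x powr real_of_int (rat_num \<beta>)) powr (1 / rat_den \<beta>)"
    using assms b(1) by (subst root_powr_inverse) (auto simp: powr_real_of_int')
  also have "\<dots> = x powr \<beta>" using b(3) by (simp add: powr_powr)
  finally show ?thesis using True by (simp add: rpow_def)
qed (use assms in \<open>simp add: rpow_def powr_def\<close>)

text \<open>For rational exponents the signed root is multiplicative, whatever the sign of \<open>y\<close>.\<close>

lemma rpow_mult_pos:
  assumes "w > 0" and "y > 0 \<or> \<beta> \<in> \<rat>"
  shows "rpow (y * w) \<beta> = rpow y \<beta> * w powr \<beta>"
proof (cases "\<beta> \<in> \<rat>")
  case True
  then have "rpow (y * w) \<beta> = rpow y \<beta> * rpow w \<beta>"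
    by (simp add: rpow_def power_int_mult_distrib real_root_mult)
  with assms show ?thesis by (simp add: rpow_eq_powr)
qed (use assms in \<open>auto simp: rpow_eq_powr powr_mult\<close>)

text \<open>For negative \<open>y\<close> the denominator \<open>q\<close> has to be odd: the proof pulls the \<open>q\<close>-th power
  of \<open>y\<^sup>k\<close>, which may be negative, out of the \<open>q\<close>-th root.\<close>

lemma rpow_diff_nat:
  assumes "y > 0 \<or> y < 0 \<and> \<beta> \<in> \<rat> \<and> odd (rat_den \<beta>)"
  shows "rpow y (\<beta> - real k) = rpow y \<beta> / y ^ k"
proof (cases "y > 0")
  case True
  then show ?thesis by (simp add: rpow_eq_powr powr_diff powr_realpow)
next
  case False
  let ?q = "rat_den \<beta>"
  from False assms have y: "y < 0" "\<beta> \<in> \<rat>" "odd ?q" by auto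
  have "rpow y (\<beta> - real k) = root ?q (y powi (rat_num \<beta> - int (k * ?q)))"
    using y by (simp add: rpow_def rat_num_den_diff_nat)
  also have "y powi (rat_num \<beta> - int (k * ?q)) = y powi rat_num \<beta> / (y ^ k) ^ ?q"
    using y by (subst power_int_diff) (auto simp: power_mult simp del: of_nat_mult)
  also have "root ?q \<dots> = root ?q (y powi rat_num \<beta>) / y ^ k"
    using y by (simp add: real_root_divide odd_real_root_power_cancel)
  finally show ?thesis using y by (simp add: rpow_def)
qed

text \<open>Factor \<open>y + h = y (1 + h/y)\<close>. The second factor is positive, so that the real binomial series
  applies to it, and the first carries the sign.\<close>

lemma rpow_binomial_series:
  assumes y: "y > 0 \<or> y < 0 \<and> \<beta> \<in> \<rat> \<and> odd (rat_den \<beta>)" and h: "\<bar>h\<bar> < \<bar>y\<bar>"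
  shows "(\<lambda>k. (\<beta> gchoose k) * rpow y (\<beta> - real k) * h ^ k) sums rpow (y + h) \<beta>"
proof -
  define z where "z = h / y"
  have y0: "y \<noteq> 0" using y by auto
  have z: "\<bar>z\<bar> < 1" "h = y * z" using h y0 by (auto simp: z_def)
  have "(\<lambda>k. rpow y \<beta> * ((\<beta> gchoose k) * z ^ k)) sums (rpow y \<beta> * (1 + z) powr \<beta>)"
    by (intro sums_mult gen_binomial_real z)
  also have "rpow y \<beta> * (1 + z) powr \<beta> = rpow (y * (1 + z)) \<beta>"
    using y z by (subst rpow_mult_pos) auto
  also have "y * (1 + z) = y + h" using z by (simp add: algebra_simps)
  also have "(\<lambda>k. rpow y \<beta> * ((\<beta> gchoose k) * z ^ k))
      = (\<lambda>k. (\<beta> gchoose k) * rpow y (\<beta> - real k) * h ^ k)"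
    using y0 by (auto simp: rpow_diff_nat[OF y] z_def power_divide)
  finally show ?thesis .
qed

text \<open>Left of \<open>d\<close> the power is real only for integers and for fractions with an even numerator;
  lowest terms make the denominator odd in both cases.\<close>

lemma rpow_domain_left:
  assumes "t \<in> rpow_domain d \<beta>" "t < d"
  shows "\<beta> \<in> \<rat> \<and> odd (rat_den \<beta>)"
proof (cases "\<beta> \<in> \<int>")
  case True
  then obtain n where "\<beta> = real_of_int n" by (auto elim: Ints_cases)
  then show ?thesis using rat_num_den_eqI[of n 1 \<beta>] by simp
next
  case False
  then have "\<beta> \<notin> \<nat>" using Nats_subset_Ints by auto
  with False assms have r: "\<beta> \<in> \<rat>" "even (rat_num \<beta>)"
    by (auto simp: rpow_domain_def split: if_splits)
  have "odd (rat_den \<beta>)"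
  proof
    assume "even (rat_den \<beta>)"
    with r(2) have "\<not> coprime (rat_num \<beta>) (int (rat_den \<beta>))"
      by (intro not_coprimeI[of 2]) auto
    with rat_num_den(2)[OF r(1)] show False by simp
  qed
  with r(1) show ?thesis by simp
qed

section \<open>Fractional derivatives of shifted powers\<close>

text \<open>The convention for quotients of two poles is the one that makes the quotient the falling
  factorial \<open>\<beta> (\<beta> - 1) \<dots> (\<beta> - k + 1)\<close> for every \<open>\<beta>\<close>.\<close>

lemma Gamma_ratio_eq_gbinomial:
  "Gamma_ratio (\<beta> + 1) (\<beta> - real k + 1) = fact k * (\<beta> gchoose k)"
proof (cases "\<beta> + 1 \<in> \<int>\<^sub>\<le>\<^sub>0")
  case True
  then obtain n where n: "\<beta> + 1 = - real n" by (auto elim!: nonpos_Ints_cases')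
  then have b: "\<beta> = - (real n + 1)" "\<beta> - real k + 1 = - real (n + k)" by simp_all
  have poch: "pochhammer (real n + 1) k = fact (n + k) / fact n"
    using pochhammer_product'[of "1::real" n k] by (simp add: pochhammer_fact[symmetric] add.commute)
  have "nat \<lfloor>real n\<rfloor> = n" "nat \<lfloor>real (n + k)\<rfloor> = n + k"
    by (simp_all only: floor_of_nat nat_int)
  moreover have "- real n \<in> \<int>\<^sub>\<le>\<^sub>0" "- real (n + k) \<in> \<int>\<^sub>\<le>\<^sub>0"
    by (intro minus_of_nat_in_nonpos_Ints)+
  ultimately have "Gamma_ratio (\<beta> + 1) (\<beta> - real k + 1) = (-1) ^ k * fact (n + k) / fact n"
    unfolding Gamma_ratio_def n b(2) Let_def minus_minus by (simp only: if_True simp_thms) simp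
  also have "\<dots> = (-1) ^ k * pochhammer (- \<beta>) k"
    unfolding b(1) minus_minus poch by simp
  also have "\<dots> = fact k * (\<beta> gchoose k)"
    unfolding gbinomial_pochhammer by simp
  finally show ?thesis .
next
  case False
  have "rGamma (\<beta> - real k + 1) = pochhammer (\<beta> - real k + 1) k * rGamma (\<beta> + 1)"
    using pochhammer_rGamma[of "\<beta> - real k + 1" k] by (simp add: algebra_simps)
  moreover have "Gamma (\<beta> + 1) * rGamma (\<beta> + 1) = 1"
    using False by (simp add: rGamma_inverse_Gamma Gamma_eq_zero_iff)
  ultimately show ?thesis
    using False by (simp add: Gamma_ratio_def gbinomial_pochhammer' mult_ac)
qed

text \<open>The singularity \<open>d\<close> has distance \<open>\<bar>a - d\<bar>\<close> from \<open>a\<close>, and this is the radius within which the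
  binomial expansion at \<open>a\<close> represents the power.\<close>

lemma has_RL_derivative_rpow:
  assumes \<alpha>: "0 < \<alpha>" "\<alpha> < 1"
    and a: "a > d \<or> a < d \<and> \<beta> \<in> \<rat> \<and> odd (rat_den \<beta>)"
    and t: "a \<le> t" "t < a + \<bar>a - d\<bar>"
  shows "\<exists>D. has_RL_derivative a \<alpha> (\<lambda>x. rpow (x - d) \<beta>) t D \<and>
    (\<lambda>k. ereal (Gamma_ratio (\<beta> + 1) (\<beta> - real k + 1) * rpow (a - d) (\<beta> - real k)
            / Gamma (- \<alpha> + real k + 1)) * epowr (t - a) (- \<alpha> + real k)) sums D"
proof -
  let ?c = "\<lambda>k. (\<beta> gchoose k) * rpow (a - d) (\<beta> - real k)"
  have y: "a - d > 0 \<or> a - d < 0 \<and> \<beta> \<in> \<rat> \<and> odd (rat_den \<beta>)" using a by auto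
  have "rpow (a - d) \<beta> \<noteq> 0"
    using y rat_num_den(1)[of \<beta>] by (auto simp: rpow_eq_powr) (auto simp: rpow_def real_root_eq_0_iff)
  then have "?c 0 \<noteq> 0" by simp
  moreover have "(\<lambda>k. ?c k * (x - a) ^ k) sums rpow (x - d) \<beta>"
    if "a \<le> x" "x < a + \<bar>a - d\<bar>" for x
    using rpow_binomial_series[OF y, of "x - a"] that by simp
  ultimately have "\<exists>D. has_RL_derivative a \<alpha> (\<lambda>x. rpow (x - d) \<beta>) t D \<and>
    (\<lambda>k. ereal (?c k * fact k / Gamma (- \<alpha> + real k + 1)) * epowr (t - a) (- \<alpha> + real k)) sums D"
    using \<alpha> t by (intro has_RL_derivative_power_series[where \<rho> = "\<bar>a - d\<bar>"]) auto
  moreover have "?c k * fact k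
      = Gamma_ratio (\<beta> + 1) (\<beta> - real k + 1) * rpow (a - d) (\<beta> - real k)" for k
    unfolding Gamma_ratio_eq_gbinomial by simp
  ultimately show ?thesis by (simp only:)
qed

text \<open>Here the series is a finite sum and converges everywhere, so that \<open>t\<close> may lie on either side
  of \<open>d\<close>, and the expansion at \<open>a\<close> reaches every \<open>t \<ge> a\<close>.\<close>

lemma has_RL_derivative_shifted_power:
  fixes a d t :: real
  assumes \<alpha>: "0 < \<alpha>" "\<alpha> < 1" and ad: "a \<noteq> d" and t: "a \<le> t"
  shows "has_RL_derivative a \<alpha> (\<lambda>x. (x - d) ^ m) t
    (\<Sum>k=0..m. ereal (Gamma (real m + 1) * (a - d) ^ (m - k)
        / (Gamma (real m - real k + 1) * Gamma (real k + 1 - \<alpha>))) * epowr (t - a) (real k - \<alpha>))"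
proof -
  let ?c = "\<lambda>k. real (m choose k) * (a - d) ^ (m - k)"
  let ?T = "\<lambda>k. ereal (?c k * fact k / Gamma (- \<alpha> + real k + 1)) * epowr (t - a) (- \<alpha> + real k)"
  have series: "(\<lambda>k. ?c k * (x - a) ^ k) sums (x - d) ^ m" for x
  proof -
    have "(x - d) ^ m = (\<Sum>k\<in>{..m}. ?c k * (x - a) ^ k)"
      using binomial_ring[of "x - a" "a - d" m] by (simp add: mult_ac)
    then show ?thesis
      using sums_finite[of "{..m}" "\<lambda>k. ?c k * (x - a) ^ k"] by simp
  qed
  have "\<exists>D. has_RL_derivative a \<alpha> (\<lambda>x. (x - d) ^ m) t D \<and> ?T sums D"
    using \<alpha> t ad
    by (intro has_RL_derivative_power_series[where \<rho> = "t - a + 1"] series) auto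
  then obtain D where D: "has_RL_derivative a \<alpha> (\<lambda>x. (x - d) ^ m) t D" "?T sums D"
    by blast
  have "?T sums (\<Sum>k\<in>{0..m}. ?T k)"
    by (rule sums_finite) (auto simp: binomial_eq_0 zero_ereal_def[symmetric])
  then have "D = (\<Sum>k=0..m. ?T k)" by (rule sums_unique2[OF D(2)])
  also have "\<dots> = (\<Sum>k=0..m. ereal (Gamma (real m + 1) * (a - d) ^ (m - k)
        / (Gamma (real m - real k + 1) * Gamma (real k + 1 - \<alpha>))) * epowr (t - a) (real k - \<alpha>))"
  proof (rule sum.cong[OF refl])
    fix k assume "k \<in> {0..m}"
    then have k: "k \<le> m" by simp
    then have G: "Gamma (real m - real k + 1) = fact (m - k)"
      using Gamma_fact[of "m - k", where 'a = real] by (simp add: of_nat_diff add.commute)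
    have "real (m choose k) * fact k = Gamma (real m + 1) / Gamma (real m - real k + 1)"
      unfolding G using Gamma_fact[of m, where 'a = real] k
      by (simp add: binomial_fact add.commute)
    moreover have "?c k * fact k / Gamma (- \<alpha> + real k + 1)
        = (real (m choose k) * fact k) * (a - d) ^ (m - k) / Gamma (- \<alpha> + real k + 1)"
      by simp
    ultimately have "?c k * fact k / Gamma (- \<alpha> + real k + 1)
        = Gamma (real m + 1) * (a - d) ^ (m - k)
          / (Gamma (real m - real k + 1) * Gamma (- \<alpha> + real k + 1))"
      by simp
    moreover have "- \<alpha> + real k + 1 = real k + 1 - \<alpha>" "- \<alpha> + real k = real k - \<alpha>" by simp_all
    ultimately show "?T k = ereal (Gamma (real m + 1) * (a - d) ^ (m - k)
        / (Gamma (real m - real k + 1) * Gamma (real k + 1 - \<alpha>))) * epowr (t - a) (real k - \<alpha>)"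
      by (simp only:)
  qed
  finally show ?thesis using D(1) by (simp only:)
qed

lemma Gamma_ratio_neg_nat:
  assumes "m \<ge> 1"
  shows "Gamma_ratio (- real m + 1) (- real m - real k + 1)
    = (-1) ^ k * Gamma (real m + real k) / Gamma (real m)"
proof -
  have "pochhammer (real m) k = Gamma (real m + real k) / Gamma (real m)"
    using assms by (intro pochhammer_Gamma) (auto elim!: nonpos_Ints_cases')
  then show ?thesis
    using Gamma_ratio_eq_gbinomial[of "- real m" k] by (simp add: gbinomial_pochhammer)
qed

theorem corollary6:
  fixes \<alpha> \<beta> d a t \<epsilon> dplus :: real and f :: "real \<Rightarrow> real" and \<Omega> :: "real set"
  assumes "0 < \<alpha>" and "\<alpha> < 1"
    and "f = (\<lambda>x. rpow (x - d) \<beta>)"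
    and "is_interval \<Omega>" and "\<Omega> \<subseteq> rpow_domain d \<beta>" and "t \<in> \<Omega>"
    and "\<epsilon> = \<bar>d - a\<bar>" and "\<epsilon> > 0"
    and "dplus = d + \<epsilon>"
  shows
    "(t \<in> {a..<a + \<epsilon> / 2} \<longrightarrow>
       (\<exists>D. has_RL_derivative a \<alpha> f t D \<and>
         (\<lambda>k. ereal (Gamma_ratio (\<beta> + 1) (\<beta> - real k + 1) * rpow (a - d) (\<beta> - real k)
                 / Gamma (- \<alpha> + real k + 1)) * epowr (t - a) (- \<alpha> + real k)) sums D))
   \<and> (t \<in> {dplus..<dplus + \<epsilon>} \<longrightarrow>
       (\<exists>D. has_RL_derivative dplus \<alpha> f t D \<and>
         (\<lambda>k. ereal (Gamma_ratio (\<beta> + 1) (\<beta> - real k + 1) * rpow \<epsilon> (\<beta> - real k)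
                 / Gamma (- \<alpha> + real k + 1)) * epowr (t - dplus) (- \<alpha> + real k)) sums D))
   \<and> (\<forall>m::nat. \<beta> = real m \<longrightarrow> t \<ge> a \<longrightarrow>
       has_RL_derivative a \<alpha> f t
         (\<Sum>k=0..m. ereal (Gamma (real m + 1) * (a - d) ^ (m - k)
                 / (Gamma (real m - real k + 1) * Gamma (real k + 1 - \<alpha>)))
               * epowr (t - a) (real k - \<alpha>)))
   \<and> (\<forall>m::nat. m \<ge> 1 \<longrightarrow> \<beta> = - real m \<longrightarrow>
       (t \<in> {a..<a + \<epsilon> / 2} \<longrightarrow>
         (\<exists>D. has_RL_derivative a \<alpha> f t D \<and>
           (\<lambda>k. ereal ((-1) ^ k * Gamma (real m + real k) * (a - d) powi (- int m - int k)
                   / (Gamma (real m) * Gamma (- \<alpha> + real k + 1)))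
                 * epowr (t - a) (- \<alpha> + real k)) sums D)) \<and>
       (t \<in> {dplus..<dplus + \<epsilon>} \<longrightarrow>
         (\<exists>D. has_RL_derivative dplus \<alpha> f t D \<and>
           (\<lambda>k. ereal ((-1) ^ k * Gamma (real m + real k) * \<epsilon> powi (- (int m + int k))
                   / (Gamma (real m) * Gamma (- \<alpha> + real k + 1)))
                 * epowr (t - dplus) (- \<alpha> + real k)) sums D)))"
    (is "?P1 \<and> ?P2 \<and> ?P3 \<and> ?P4")
proof (intro conjI)
  note \<alpha> = assms(1,2) and f = assms(3) and \<epsilon> = assms(7,8) and dplus = assms(9)
  show P1: ?P1
  proof
    assume t: "t \<in> {a..<a + \<epsilon> / 2}"
    (* For a < d the point t lies left of d as well, so that the domain restricts the exponent. *)
    have "a > d \<or> a < d \<and> \<beta> \<in> \<rat> \<and> odd (rat_den \<beta>)"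
    proof (cases "a < d")
      case True
      then have "t < d" using t \<epsilon> by (simp add: field_simps)
      with True show ?thesis using rpow_domain_left[of t d \<beta>] assms(5,6) by auto
    qed (use \<epsilon> in auto)
    moreover have "t < a + \<bar>a - d\<bar>" using t \<epsilon> by (auto simp: abs_if field_simps split: if_splits)
    ultimately show "\<exists>D. has_RL_derivative a \<alpha> f t D \<and>
         (\<lambda>k. ereal (Gamma_ratio (\<beta> + 1) (\<beta> - real k + 1) * rpow (a - d) (\<beta> - real k)
                 / Gamma (- \<alpha> + real k + 1)) * epowr (t - a) (- \<alpha> + real k)) sums D"
      unfolding f using t by (intro has_RL_derivative_rpow \<alpha>) auto
  qed
  show P2: ?P2
  proof
    assume t: "t \<in> {dplus..<dplus + \<epsilon>}"
    have e: "\<epsilon> = dplus - d" using dplus by simp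
    have "dplus > d" "t < dplus + \<bar>dplus - d\<bar>" using t \<epsilon>(2) dplus by auto
    then show "\<exists>D. has_RL_derivative dplus \<alpha> f t D \<and>
         (\<lambda>k. ereal (Gamma_ratio (\<beta> + 1) (\<beta> - real k + 1) * rpow \<epsilon> (\<beta> - real k)
                 / Gamma (- \<alpha> + real k + 1)) * epowr (t - dplus) (- \<alpha> + real k)) sums D"
      unfolding f e using t by (intro has_RL_derivative_rpow \<alpha>) auto
  qed
  show ?P3
  proof (intro allI impI)
    fix m :: nat
    assume "\<beta> = real m" "t \<ge> a"
    moreover from this have "f = (\<lambda>x. (x - d) ^ m)"
      unfolding f using rpow_of_int[of _ "int m"] by simp
    ultimately show "has_RL_derivative a \<alpha> f t
         (\<Sum>k=0..m. ereal (Gamma (real m + 1) * (a - d) ^ (m - k)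
                 / (Gamma (real m - real k + 1) * Gamma (real k + 1 - \<alpha>)))
               * epowr (t - a) (real k - \<alpha>))"
      using has_RL_derivative_shifted_power[OF \<alpha>, of a d t m] \<epsilon> by auto
  qed
  show ?P4
  proof (intro allI impI)
    fix m :: nat
    assume m: "m \<ge> 1" "\<beta> = - real m"
    have pow: "rpow x (\<beta> - real k) = x powi (- int m - int k)" for x k
      using rpow_of_int[of x "- int m - int k"] m(2) by simp
    have coeff: "Gamma_ratio (\<beta> + 1) (\<beta> - real k + 1) * rpow x (\<beta> - real k) / Gamma (- \<alpha> + real k + 1)
        = (-1) ^ k * Gamma (real m + real k) * x powi (- int m - int k)
                   / (Gamma (real m) * Gamma (- \<alpha> + real k + 1))" for x k
      unfolding pow unfolding m(2) Gamma_ratio_neg_nat[OF m(1)] by simp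
    have neg: "- (int m + int k) = - int m - int k" for k by simp
    show "(t \<in> {a..<a + \<epsilon> / 2} \<longrightarrow>
         (\<exists>D. has_RL_derivative a \<alpha> f t D \<and>
           (\<lambda>k. ereal ((-1) ^ k * Gamma (real m + real k) * (a - d) powi (- int m - int k)
                   / (Gamma (real m) * Gamma (- \<alpha> + real k + 1)))
                 * epowr (t - a) (- \<alpha> + real k)) sums D)) \<and>
       (t \<in> {dplus..<dplus + \<epsilon>} \<longrightarrow>
         (\<exists>D. has_RL_derivative dplus \<alpha> f t D \<and>
           (\<lambda>k. ereal ((-1) ^ k * Gamma (real m + real k) * \<epsilon> powi (- (int m + int k))
                   / (Gamma (real m) * Gamma (- \<alpha> + real k + 1)))
                 * epowr (t - dplus) (- \<alpha> + real k)) sums D))"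
      using P1 P2 unfolding coeff neg by (rule conjI)
  qed
qed

end
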